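(* Let $E,F$ be Banach spaces, $U\subset E$ open, $f:U\to F$ a $C^1$ map, and let $x_0\in U$ be a generalized regular point of $f$. Let $T_0^+$ be a generalized inverse of $f'(x_0)$, let $E_*=R(T_0^+)$, and let $U_0\subset U$ be a neighborhood of $x_0$ such that $$\|f'(x)-f'(x_0)\|<\|T_0^+\|^{-1}\quad\text{and}\quad R(f'(x))\cap N(T_0^+)=\{0\}\qquad\text{for all }x\in U_0.$$ Then, for the family $\mathcal{F}=\{N(f'(x)): x\in U_0\}$, the co-final set $J(x_0,E_* )$ is trivial, and $\mathcal{F}$ is $C^1$ integrable at $x_0$.
   Context: $N(T)$ and $R(T)$ denote the kernel and range of $T$; $B(E,F)$ the bounded linear operators with the operator norm. Direct sums: $E=A\oplus B$ means that $A,B$ are closed subspaces with $A+B=E$ and $A\cap B=\{0\}$. A subspace $A$ splits in $E$ if it is closed and $E=A\oplus B$ for some closed $B$. Generalized inverse: $A^+\in B(F,E)$ is a generalized inverse of $A\in B(E,F)$ if $A^+AA^+=A^+$ and $AA^+A=A$. $A$ is double splitting if $R(A)$ is closed and $N(A)$, $R(A)$ split in $E$, $F$ respectively; equivalently, $A$ has a generalized inverse in $B(F,E)$. Generalized regular point: $x_0\in U$ is a generalized regular point of $f$ if $x_0$ is a locally fine point of $x\mapsto f'(x)$, meaning: $f'(x_0)$ is double splitting and there exist a generalized inverse $T_0^+$ of $f'(x_0)$ and a neighborhood $U_0$ of $x_0$ with $R(f'(x))\cap N(T_0^+)=\{0\}$ for all $x\in U_0$. (This property is independent of the choice of $T_0^+$,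 with $U_0$ depending on $T_0^+$; together with continuity of $f'$, a neighborhood $U_0$ as in the claim exists for each $T_0^+$.) Convention: $\|T_0^+\|^{-1}=+\infty$ if $T_0^+=0$. $C^1$ submanifold: a subset $S\subset E$ is a $C^1$ submanifold if for each $p\in S$ there are a subspace $E_0$ splitting in $E$, an open neighborhood $W$ of $p$ in $E$, and a $C^1$ diffeomorphism $\varphi:W\to\varphi(W)$ onto an open subset of $E$, such that $\varphi(S\cap W)$ is an open set in $E_0$. For a family of subspaces $\mathcal{F}=\{M(x)\}_{x\in\Lambda}$ ($\Lambda\subset E$ open; here $\Lambda=U_0$, taken open, and $M(x)=N(f'(x))$): a $C^1$ submanifold $S\subset\Lambda$ is tangent to $M(x)$ at $x\in S$ if $M(x)=\{\dot c(0): c \text{ a } C^1\text{-curve},\ c(t)\in S,\ c(0)=x\}$; $\mathcal{F}$ is $C^1$ integrable at $x_0$ if there is a $C^1$ submanifold $S\subset\Lambda$ with $x_0\in S$ tangent to $M(x)$ at every $x\in S$. With $M_0=M(x_0)$ and $E=M_0\oplus E_*$, the co-final set is $J(x_0,E_* )=\{x\in\Lambda: M(x)\oplus E_*=E\}$; for each $x\in J(x_0,E_* )$ there is a unique $\alpha(x)\in B(M_0,E_* )$ with $M(x)=\{e+\alpha(x)e: e\in M_0\}$. $J(x_0,E_* )$ is trivial if $x_0$ is an interior point of $J(x_0,E_* )$ and $x\mapsto\alpha(x)\in B(M_0,E_* )$ is continuous in some neighborhood of $x_0$. *)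

theory Defs
  imports "HOL-Analysis.Analysis"
begin

definition bl_kernel :: "('a::real_normed_vector \<Rightarrow>\<^sub>L 'b::real_normed_vector) \<Rightarrow> 'a set"
  where "bl_kernel A = {x. blinfun_apply A x = 0}"

definition bl_range :: "('a::real_normed_vector \<Rightarrow>\<^sub>L 'b::real_normed_vector) \<Rightarrow> 'b set"
  where "bl_range A = range (blinfun_apply A)"

definition direct_sum_decomp :: "'a::real_normed_vector set \<Rightarrow> 'a set \<Rightarrow> bool"
  where "direct_sum_decomp A B \<longleftrightarrow>
    subspace A \<and> closed A \<and> subspace B \<and> closed B \<and>
    {a + b |a b. a \<in> A \<and> b \<in> B} = UNIV \<and> A \<inter> B = {0}"

definition splits :: "'a::real_normed_vector set \<Rightarrow> bool"
  where "splits A \<longleftrightarrow> (\<exists>B. direct_sum_decomp A B)"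

definition generalized_inverse ::
  "('a::real_normed_vector \<Rightarrow>\<^sub>L 'b::real_normed_vector) \<Rightarrow> ('b \<Rightarrow>\<^sub>L 'a) \<Rightarrow> bool"
  where "generalized_inverse A A' \<longleftrightarrow>
    A' o\<^sub>L A o\<^sub>L A' = A' \<and> A o\<^sub>L A' o\<^sub>L A = A"

definition double_splitting ::
  "('a::real_normed_vector \<Rightarrow>\<^sub>L 'b::real_normed_vector) \<Rightarrow> bool"
  where "double_splitting A \<longleftrightarrow>
    closed (bl_range A) \<and> splits (bl_kernel A) \<and> splits (bl_range A)"

definition C1_with_derivative ::
  "'a::real_normed_vector set \<Rightarrow> ('a \<Rightarrow> 'b::real_normed_vector) \<Rightarrow> ('a \<Rightarrow> 'a \<Rightarrow>\<^sub>L 'b) \<Rightarrow> bool"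
  where "C1_with_derivative U f f' \<longleftrightarrow>
    (\<forall>x\<in>U. (f has_derivative blinfun_apply (f' x)) (at x)) \<and> continuous_on U f'"

definition C1_map_on ::
  "'a::real_normed_vector set \<Rightarrow> ('a \<Rightarrow> 'b::real_normed_vector) \<Rightarrow> bool"
  where "C1_map_on U f \<longleftrightarrow> (\<exists>f'. C1_with_derivative U f f')"

definition locally_fine_point ::
  "'a::real_normed_vector set \<Rightarrow> ('a \<Rightarrow> 'c::real_normed_vector \<Rightarrow>\<^sub>L 'b::real_normed_vector) \<Rightarrow> 'a \<Rightarrow> bool"
  where "locally_fine_point U T x\<^sub>0 \<longleftrightarrow>
    x\<^sub>0 \<in> U \<and> double_splitting (T x\<^sub>0) \<and>
    (\<exists>T\<^sub>0' U\<^sub>0. generalized_inverse (T x\<^sub>0) T\<^sub>0' \<and>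
      open U\<^sub>0 \<and> x\<^sub>0 \<in> U\<^sub>0 \<and> U\<^sub>0 \<subseteq> U \<and>
      (\<forall>x\<in>U\<^sub>0. bl_range (T x) \<inter> bl_kernel T\<^sub>0' = {0}))"

text \<open>For open \<open>U\<close> the derivative is unique, so the choice of \<open>f'\<close> does not matter.\<close>

definition generalized_regular_point ::
  "'a::real_normed_vector set \<Rightarrow> ('a \<Rightarrow> 'b::real_normed_vector) \<Rightarrow> 'a \<Rightarrow> bool"
  where "generalized_regular_point U f x\<^sub>0 \<longleftrightarrow>
    (\<exists>f'. C1_with_derivative U f f' \<and> locally_fine_point U f' x\<^sub>0)"

definition C1_diffeo_on :: "'a::real_normed_vector set \<Rightarrow> ('a \<Rightarrow> 'a) \<Rightarrow> bool"
  where "C1_diffeo_on W \<phi> \<longleftrightarrow>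
    open W \<and> open (\<phi> ` W) \<and> C1_map_on W \<phi> \<and>
    (\<exists>\<psi>. C1_map_on (\<phi> ` W) \<psi> \<and> (\<forall>x\<in>W. \<psi> (\<phi> x) = x))"

definition C1_submanifold :: "'a::real_normed_vector set \<Rightarrow> bool"
  where "C1_submanifold S \<longleftrightarrow>
    (\<forall>p\<in>S. \<exists>E\<^sub>0 W \<phi>. splits E\<^sub>0 \<and> p \<in> W \<and> C1_diffeo_on W \<phi> \<and>
      openin (top_of_set E\<^sub>0) (\<phi> ` (S \<inter> W)))"

definition velocities :: "'a::real_normed_vector set \<Rightarrow> 'a \<Rightarrow> 'a set"
  where "velocities S x =
    {v. \<exists>(c :: real \<Rightarrow> 'a) \<epsilon>. 0 < \<epsilon> \<and> c C1_differentiable_on {-\<epsilon><..<\<epsilon>} \<and>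
      (\<forall>t\<in>{-\<epsilon><..<\<epsilon>}. c t \<in> S) \<and> c 0 = x \<and> (c has_vector_derivative v) (at 0)}"

definition C1_integrable_at ::
  "'a::real_normed_vector set \<Rightarrow> ('a \<Rightarrow> 'a set) \<Rightarrow> 'a \<Rightarrow> bool"
  where "C1_integrable_at \<Lambda> M x\<^sub>0 \<longleftrightarrow>
    (\<exists>S. C1_submanifold S \<and> S \<subseteq> \<Lambda> \<and> x\<^sub>0 \<in> S \<and> (\<forall>x\<in>S. M x = velocities S x))"

definition cofinal_set ::
  "'a::real_normed_vector set \<Rightarrow> ('a \<Rightarrow> 'a set) \<Rightarrow> 'a set \<Rightarrow> 'a set"
  where "cofinal_set \<Lambda> M Es = {x\<in>\<Lambda>. direct_sum_decomp (M x) Es}"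

text \<open>\<open>B(A,B)\<close> for subspaces \<open>A\<close>, \<open>B\<close>: functions on \<open>A\<close> only, i.e. equal to
  \<^const>\<open>undefined\<close> outside \<open>A\<close>, so that such an operator is determined by its values on \<open>A\<close>.\<close>

definition bounded_ops ::
  "'a::real_normed_vector set \<Rightarrow> 'b::real_normed_vector set \<Rightarrow> ('a \<Rightarrow> 'b) set"
  where "bounded_ops A B =
    {T \<in> A \<rightarrow>\<^sub>E B. (\<forall>x\<in>A. \<forall>y\<in>A. T (x + y) = T x + T y) \<and>
      (\<forall>r. \<forall>x\<in>A. T (r *\<^sub>R x) = r *\<^sub>R T x) \<and>
      (\<exists>K. \<forall>x\<in>A. norm (T x) \<le> K * norm x)}"

definition onorm_on ::
  "'a::real_normed_vector set \<Rightarrow> ('a \<Rightarrow> 'b::real_normed_vector) \<Rightarrow> real"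
  where "onorm_on A T = (SUP x\<in>A. norm (T x) / norm x)"

definition is_graph_op ::
  "'a::real_normed_vector set \<Rightarrow> 'a set \<Rightarrow> 'a set \<Rightarrow> ('a \<Rightarrow> 'a) \<Rightarrow> bool"
  where "is_graph_op M\<^sub>0 Es N a \<longleftrightarrow>
    a \<in> bounded_ops M\<^sub>0 Es \<and> N = {e + a e |e. e \<in> M\<^sub>0}"

lemma is_graph_op_unique:
  assumes "direct_sum_decomp M\<^sub>0 Es" "is_graph_op M\<^sub>0 Es N a" "is_graph_op M\<^sub>0 Es N b"
  shows "a = b"
proof (rule extensionalityI[where A = M\<^sub>0])
  have sub: "subspace M\<^sub>0" "subspace Es" and int: "M\<^sub>0 \<inter> Es = {0}"
    using assms(1) by (auto simp: direct_sum_decomp_def)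
  have a: "a \<in> M\<^sub>0 \<rightarrow>\<^sub>E Es" and b: "b \<in> M\<^sub>0 \<rightarrow>\<^sub>E Es"
    using assms(2,3) by (auto simp: is_graph_op_def bounded_ops_def)
  then show "a \<in> extensional M\<^sub>0" "b \<in> extensional M\<^sub>0"
    by (auto simp: PiE_def)
  fix e assume e: "e \<in> M\<^sub>0"
  then have "e + a e \<in> {e + b e |e. e \<in> M\<^sub>0}"
    using assms(2,3) by (auto simp: is_graph_op_def)
  then obtain d where d: "d \<in> M\<^sub>0" "e + a e = d + b d" by auto
  have "e - d \<in> M\<^sub>0" using sub e d by (simp add: subspace_diff)
  moreover have "b d - a e \<in> Es" using sub a b e d by (auto intro!: subspace_diff)
  moreover have "e - d = b d - a e" using d(2) by (simp add: algebra_simps)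
  ultimately have "e - d \<in> M\<^sub>0 \<inter> Es" by simp
  then have "e = d" using int by simp
  then show "a e = b e" using d(2) by simp
qed

text \<open>By \<open>is_graph_op_unique\<close> the family \<open>\<alpha>\<close> below is determined on the co-final set as soon
  as \<open>direct_sum_decomp (M x\<^sub>0) Es\<close>; its existence is part of the definition.
  Continuity is with respect to the operator norm of \<open>B(M x\<^sub>0, Es)\<close>.\<close>

definition cofinal_trivial ::
  "'a::real_normed_vector set \<Rightarrow> ('a \<Rightarrow> 'a set) \<Rightarrow> 'a \<Rightarrow> 'a set \<Rightarrow> bool"
  where "cofinal_trivial \<Lambda> M x\<^sub>0 Es \<longleftrightarrow>
    x\<^sub>0 \<in> interior (cofinal_set \<Lambda> M Es) \<and>
    (\<exists>\<alpha>. (\<forall>x\<in>cofinal_set \<Lambda> M Es. is_graph_op (M x\<^sub>0) Es (M x) (\<alpha> x)) \<and>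
      (\<exists>V. open V \<and> x\<^sub>0 \<in> V \<and> V \<subseteq> cofinal_set \<Lambda> M Es \<and>
        (\<forall>x\<in>V. ((\<lambda>y. onorm_on (M x\<^sub>0) (\<lambda>e. \<alpha> y e - \<alpha> x e)) \<longlongrightarrow> 0) (at x))))"

end

theory Submission
  imports Defs
begin

text \<open>
  Write \<open>T\<close> for the derivative at \<open>x\<^sub>0\<close>, \<open>K x = T\<^sub>0' (f' x - T)\<close> and \<open>P = T\<^sub>0' T\<close>, the projection
  onto \<open>R(T\<^sub>0')\<close> along \<open>N(T)\<close>. The norm condition makes \<open>A x = id + K x\<close> invertible, and
  \<open>T\<^sub>0' f' x = P (A x)\<close>. As \<open>R(f' x)\<close> meets \<open>N(T\<^sub>0')\<close> only in 0, it follows that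
  \<open>N(f' x) = (A x)\<inverse> N(T)\<close>. Since \<open>K x\<close> takes its values in \<open>R(T\<^sub>0')\<close>, the space \<open>N(f' x)\<close> is the
  graph of \<open>(A x)\<inverse> - id\<close> over \<open>N(T)\<close>, which depends continuously on \<open>x\<close>. Finally \<open>A\<close> is the derivative of
  \<open>\<phi> y = y + T\<^sub>0' (f y - T y) + const\<close>, which is a diffeomorphism near \<open>x\<^sub>0\<close>; the preimage of
  \<open>N(T)\<close> under \<open>\<phi>\<close> is the integral manifold.
\<close>

section \<open>Contractive perturbations of the identity\<close>

text \<open>Solutions are the fixed points of \<open>x \<mapsto> y - g x\<close>, a contraction with
  factor \<open>k\<close>. It moves the centre \<open>z\<close> by at most
  \<open>(1 - k) * s\<close>, and the variation of \<open>g\<close> adds at most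
  \<open>k * s\<close>, so the closed ball is mapped into itself. This yields surjectivity of id + K
  and openness of the image of a map close to the identity.\<close>

lemma contraction_solvable:
  fixes g :: "'a::banach \<Rightarrow> 'a"
  assumes k: "0 \<le> k" "k < 1" and s: "0 \<le> s"
    and lip: "\<And>u v. u \<in> cball z s \<Longrightarrow> v \<in> cball z s \<Longrightarrow> norm (g u - g v) \<le> k * norm (u - v)"
    and y: "norm (y - (z + g z)) \<le> (1 - k) * s"
  shows "\<exists>x\<in>cball z s. x + g x = y"
proof -
  have z: "z \<in> cball z s" using s by simp
  have "\<exists>!x\<in>cball z s. y - g x = x"
  proof (rule Banach_fix[OF _ _ k])
    show "(\<lambda>x. y - g x) ` cball z s \<subseteq> cball z s"
    proof clarify
      fix u assume u: "u \<in> cball z s"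
      have "norm (y - g u - z) \<le> norm (y - (z + g z)) + norm (g z - g u)"
        using norm_triangle_ineq[of "y - (z + g z)" "g z - g u"] by (simp add: algebra_simps)
      also have "norm (g z - g u) \<le> k * norm (z - u)" using lip[OF z u] .
      also have "\<dots> \<le> k * s" using u k by (intro mult_left_mono) (auto simp: dist_norm)
      finally have "norm (y - g u - z) \<le> s" using y by (simp add: algebra_simps)
      then show "y - g u \<in> cball z s" by (simp add: dist_norm norm_minus_commute)
    qed
    show "dist (y - g u) (y - g v) \<le> k * dist u v" if "u \<in> cball z s" "v \<in> cball z s" for u v
      using lip[OF that] by (simp add: dist_norm norm_minus_commute)
  qed (use s in \<open>auto simp: complete_eq_closed\<close>)
  then obtain x where "x \<in> cball z s" "y - g x = x" by blast
  then show ?thesis by (intro bexI[of _ x]) (auto simp: algebra_simps)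
qed

lemma contraction_expansive:
  fixes u v :: "'a::real_normed_vector"
  assumes "norm (g u - g v) \<le> k * norm (u - v)"
  shows "(1 - k) * norm (u - v) \<le> norm ((u + g u) - (v + g v))"
proof -
  have "norm (u - v) \<le> norm ((u + g u) - (v + g v)) + norm (g v - g u)"
    using norm_triangle_ineq[of "(u + g u) - (v + g v)" "g v - g u"] by (simp add: algebra_simps)
  then show ?thesis using assms by (simp add: norm_minus_commute algebra_simps)
qed

text \<open>\<open>Blinfun\<close> returns the intended operator only where the set-theoretic
  inverse is bounded linear; \<open>norm K < 1\<close> guarantees this.\<close>

definition id_plus_inv :: "('a::banach \<Rightarrow>\<^sub>L 'a) \<Rightarrow> 'a \<Rightarrow>\<^sub>L 'a"
  where "id_plus_inv K = Blinfun (inv (blinfun_apply (id_blinfun + K)))"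

lemma id_plus_bij_bound:
  fixes K :: "'a::banach \<Rightarrow>\<^sub>L 'a"
  assumes "norm K < 1"
  shows "bij (blinfun_apply (id_blinfun + K))"
    and "(1 - norm K) * norm u \<le> norm ((id_blinfun + K) u)"
proof -
  have lip: "norm (K u - K v) \<le> norm K * norm (u - v)" for u v
    by (metis blinfun.diff_right norm_blinfun)
  have exp: "(1 - norm K) * norm (u - v) \<le> norm ((id_blinfun + K) u - (id_blinfun + K) v)" for u v
    using contraction_expansive[of "blinfun_apply K", OF lip] by (simp add: blinfun.add_left)
  from exp[of u 0] show "(1 - norm K) * norm u \<le> norm ((id_blinfun + K) u)"
    by (simp add: blinfun.zero_right)
  show "bij (blinfun_apply (id_blinfun + K))"
  proof (rule bijI)
    show "inj (blinfun_apply (id_blinfun + K))"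
    proof (rule injI)
      fix u v assume "(id_blinfun + K) u = (id_blinfun + K) v"
      then have "(1 - norm K) * norm (u - v) \<le> 0" using exp[of u v] by simp
      then show "u = v" using assms by (simp add: mult_le_0_iff)
    qed
    show "surj (blinfun_apply (id_blinfun + K))"
      unfolding surj_def
    proof
      fix y :: 'a
      \<comment> \<open>The radius solves \<open>(1 - k) * s = norm y\<close> for
        \<open>k = norm K\<close>; with centre 0 this is the required bound on
        \<open>y\<close>.\<close>
      have "\<exists>x\<in>cball 0 (norm y / (1 - norm K)). x + K x = y"
        by (rule contraction_solvable[where k = "norm K"]) (use assms lip in \<open>auto simp: blinfun.zero_right\<close>)
      then show "\<exists>x. y = (id_blinfun + K) x" by (auto simp: blinfun.add_left)
    qed
  qed
qed

lemma id_plus_inv: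
  fixes K :: "'a::banach \<Rightarrow>\<^sub>L 'a"
  assumes "norm K < 1"
  shows id_plus_inv_left: "id_plus_inv K (v + K v) = v"
    and id_plus_inv_right: "id_plus_inv K v + K (id_plus_inv K v) = v"
    and norm_id_plus_inv: "norm (id_plus_inv K) \<le> 1 / (1 - norm K)"
proof -
  let ?A = "blinfun_apply (id_blinfun + K)"
  note bij = id_plus_bij_bound(1)[OF assms]
  have right: "?A (inv ?A y) = y" for y using bij by (simp add: bij_is_surj surj_f_inv_f)
  have left: "inv ?A (?A y) = y" for y using bij by (simp add: bij_is_inj)
  have lin: "linear (inv ?A)"
  proof (rule linearI)
    show "inv ?A (u + v) = inv ?A u + inv ?A v" for u v
      by (metis left right blinfun.add_right)
    show "inv ?A (c *\<^sub>R u) = c *\<^sub>R inv ?A u" for c u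
      by (metis left right blinfun.scaleR_right)
  qed
  have bd: "norm (inv ?A y) \<le> 1 / (1 - norm K) * norm y" for y
    using id_plus_bij_bound(2)[OF assms, of "inv ?A y"] assms right[of y]
    by (simp add: field_simps)
  have bl: "bounded_linear (inv ?A)"
    using lin bd by (auto intro!: bounded_linear_intro[where K = "1 / (1 - norm K)"]
        simp: linear_add linear_scale mult.commute)
  have ap: "blinfun_apply (id_plus_inv K) = inv ?A"
    unfolding id_plus_inv_def by (rule bounded_linear_Blinfun_apply[OF bl])
  show "id_plus_inv K (v + K v) = v" using left[of v] ap by (simp add: blinfun.add_left)
  show "id_plus_inv K v + K (id_plus_inv K v) = v" using right[of v] ap by (simp add: blinfun.add_left)
  show "norm (id_plus_inv K) \<le> 1 / (1 - norm K)"
    using assms by (intro norm_blinfun_bound) (use bd in \<open>auto simp: ap\<close>)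
qed

text \<open>Resolvent identity: the difference of the two inverses is the product of one inverse,
  \<open>L - K\<close> and the other inverse. Each inverse has norm at most 2, whence the constant
  4.\<close>

lemma id_plus_inv_lipschitz:
  fixes K L :: "'a::banach \<Rightarrow>\<^sub>L 'a"
  assumes K: "norm K \<le> 1/2" and L: "norm L \<le> 1/2"
  shows "norm (id_plus_inv K - id_plus_inv L) \<le> 4 * norm (K - L)"
proof -
  have n: "norm K < 1" "norm L < 1" using assms by auto
  have b: "norm (id_plus_inv M) \<le> 2" if "norm M \<le> 1/2" for M :: "'a \<Rightarrow>\<^sub>L 'a"
  proof -
    have "norm (id_plus_inv M) \<le> 1 / (1 - norm M)" using that by (intro norm_id_plus_inv) auto
    also have "\<dots> \<le> 2" using that by (simp add: field_simps)
    finally show ?thesis .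
  qed
  have "id_plus_inv K - id_plus_inv L = id_plus_inv K o\<^sub>L (L - K) o\<^sub>L id_plus_inv L"
  proof (rule blinfun_eqI)
    fix v
    define w where "w = id_plus_inv L v"
    have v: "v = w + L w" unfolding w_def using id_plus_inv_right[OF n(2)] by simp
    have "id_plus_inv K v - id_plus_inv K (w + K w) = id_plus_inv K (L w - K w)"
      by (simp add: v blinfun.diff_right blinfun.add_right)
    then show "(id_plus_inv K - id_plus_inv L) v = (id_plus_inv K o\<^sub>L (L - K) o\<^sub>L id_plus_inv L) v"
      using id_plus_inv_left[OF n(1), of w] by (simp add: blinfun.diff_left w_def)
  qed
  also have "norm \<dots> \<le> norm (id_plus_inv K) * norm (L - K) * norm (id_plus_inv L)"
    by (meson mult_right_mono norm_blinfun_compose norm_ge_zero order_trans)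
  also have "\<dots> \<le> 2 * norm (L - K) * 2"
    using b[OF K] b[OF L] by (intro mult_mono) auto
  finally show ?thesis by (simp add: norm_minus_commute)
qed

lemma continuous_on_id_plus_inv:
  fixes K :: "'b::topological_space \<Rightarrow> 'a::banach \<Rightarrow>\<^sub>L 'a"
  assumes "continuous_on S K" "\<And>x. x \<in> S \<Longrightarrow> norm (K x) \<le> 1/2"
  shows "continuous_on S (\<lambda>x. id_plus_inv (K x))"
proof -
  have "4-lipschitz_on {M. norm M \<le> 1/2} (id_plus_inv :: ('a \<Rightarrow>\<^sub>L 'a) \<Rightarrow> _)"
    by (rule lipschitz_onI) (auto simp: dist_norm id_plus_inv_lipschitz)
  then have "continuous_on {M. norm M \<le> 1/2} (id_plus_inv :: ('a \<Rightarrow>\<^sub>L 'a) \<Rightarrow> _)"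
    by (rule lipschitz_on_continuous_on)
  from continuous_on_compose2[OF this assms(1)] assms(2) show ?thesis by auto
qed

text \<open>An inverse function theorem on a prescribed ball: the bound 1/2 holds on all of it, so
  the ball need not shrink. The derivative of the inverse is kept explicit because the velocities of
  curves pulled back by \<psi> are computed from it.\<close>

lemma ball_diffeo_near_id:
  fixes \<phi> :: "'a::banach \<Rightarrow> 'a"
  assumes der: "\<And>x. x \<in> ball a r \<Longrightarrow> (\<phi> has_derivative blinfun_apply (id_blinfun + K x)) (at x)"
    and contK: "continuous_on (ball a r) K"
    and small: "\<And>x. x \<in> ball a r \<Longrightarrow> norm (K x) \<le> 1/2"
  obtains \<psi> where "C1_diffeo_on (ball a r) \<phi>" "\<And>x. x \<in> ball a r \<Longrightarrow> \<psi> (\<phi> x) = x"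
    "C1_with_derivative (\<phi> ` ball a r) \<psi> (\<lambda>y. id_plus_inv (K (\<psi> y)))"
proof -
  let ?W = "ball a r"
  \<comment> \<open>By convexity of the ball, the mean value inequality turns the bound on
    \<open>K\<close> into the Lipschitz constant 1/2 for this perturbation.\<close>
  define g where "g x = \<phi> x - x" for x
  have \<phi>: "\<phi> x = x + g x" for x by (simp add: g_def)
  have dg: "(g has_derivative blinfun_apply (K x)) (at x within ?W)" if "x \<in> ?W" for x
  proof -
    have "(g has_derivative (\<lambda>h. (id_blinfun + K x) h - h)) (at x)"
      unfolding g_def by (intro has_derivative_diff der that has_derivative_ident)
    then show ?thesis by (simp add: blinfun.add_left has_derivative_at_withinI)
  qed
  have lip: "norm (g u - g v) \<le> 1/2 * norm (u - v)" if "u \<in> ?W" "v \<in> ?W" for u v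
    using differentiable_bound[OF convex_ball dg _ that, of "1/2"] small
    by (simp add: norm_blinfun.rep_eq)
  have exp: "norm (u - v) \<le> 2 * norm (\<phi> u - \<phi> v)" if "u \<in> ?W" "v \<in> ?W" for u v
    using contraction_expansive[of g, OF lip[OF that]] by (simp add: \<phi>)
  then have inj: "inj_on \<phi> ?W" by (fastforce intro: inj_onI)
  define \<psi> where "\<psi> = inv_into ?W \<phi>"
  have \<psi>\<phi>: "\<psi> (\<phi> x) = x" if "x \<in> ?W" for x
    using inj that by (simp add: \<psi>_def)
  have opn: "open (\<phi> ` ?W)"
    unfolding open_contains_ball
  proof clarify
    fix z assume z: "z \<in> ?W"
    then obtain s where s: "s > 0" "cball z s \<subseteq> ?W"
      using open_contains_cball[of ?W] open_ball by blast
    \<comment> \<open>The radius \<open>s/2\<close> is \<open>(1 - k) * s\<close> with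
      \<open>k = 1/2\<close>.\<close>
    have "y \<in> \<phi> ` ?W" if "y \<in> ball (\<phi> z) (s/2)" for y
    proof -
      have "\<exists>x\<in>cball z s. x + g x = y"
        by (rule contraction_solvable[where k = "1/2"])
          (use s lip that in \<open>auto simp: \<phi> dist_norm norm_minus_commute subset_iff\<close>)
      then show ?thesis using s by (auto simp: \<phi> image_iff)
    qed
    then show "\<exists>e>0. ball (\<phi> z) e \<subseteq> \<phi> ` ?W" using s by (intro exI[of _ "s/2"]) auto
  qed
  \<comment> \<open>The expansion estimate for \<phi>, read for its inverse. It supplies the
    continuity from which differentiability of \<psi> follows.\<close>
  have "2-lipschitz_on (\<phi> ` ?W) \<psi>"
    by (rule lipschitz_onI) (auto simp: dist_norm \<psi>\<phi> exp)
  then have cont\<psi>: "continuous_on (\<phi> ` ?W) \<psi>"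
    by (rule lipschitz_on_continuous_on)
  have contd: "continuous_on (\<phi> ` ?W) (\<lambda>y. id_plus_inv (K (\<psi> y)))"
    using small by (intro continuous_on_id_plus_inv continuous_on_compose2[OF contK cont\<psi>]) (auto simp: \<psi>\<phi>)
  have C1: "C1_with_derivative (\<phi> ` ?W) \<psi> (\<lambda>y. id_plus_inv (K (\<psi> y)))"
    unfolding C1_with_derivative_def
  proof (intro conjI contd ballI)
    fix y assume y: "y \<in> \<phi> ` ?W"
    then obtain x where x: "x \<in> ?W" "y = \<phi> x" by blast
    have n: "norm (K x) < 1" using small[OF x(1)] by simp
    show "(\<psi> has_derivative blinfun_apply (id_plus_inv (K (\<psi> y)))) (at y)"
    proof (rule has_derivative_inverse_basic[OF _ _ _ _ opn y])
      show "(\<phi> has_derivative blinfun_apply (id_blinfun + K x)) (at (\<psi> y))"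
        using der x by (simp add: \<psi>\<phi>)
      show "blinfun_apply (id_plus_inv (K (\<psi> y))) \<circ> blinfun_apply (id_blinfun + K x) = id"
        using x by (auto simp: \<psi>\<phi> blinfun.add_left id_plus_inv_left[OF n])
      show "continuous (at y) \<psi>"
        using cont\<psi> opn y continuous_on_eq_continuous_at by blast
      show "\<phi> (\<psi> z) = z" if "z \<in> \<phi> ` ?W" for z using that by (auto simp: \<psi>\<phi>)
    qed (rule blinfun.bounded_linear_right)
  qed
  have "C1_with_derivative ?W \<phi> (\<lambda>x. id_blinfun + K x)"
    unfolding C1_with_derivative_def using der by (auto intro!: continuous_intros contK)
  then have "C1_diffeo_on ?W \<phi>"
    unfolding C1_diffeo_on_def C1_map_on_def using opn C1 \<psi>\<phi> by blast
  with \<psi>\<phi> C1 show thesis using that by blast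
qed

section \<open>Kernels of the derivatives\<close>

lemma subspace_bl_kernel: "subspace (bl_kernel A)"
  by (auto simp: bl_kernel_def subspace_def blinfun.bilinear_simps)

lemma closed_bl_kernel: "closed (bl_kernel A)"
  unfolding bl_kernel_def by (intro closed_Collect_eq continuous_intros)

lemma subspace_bl_range: "subspace (bl_range A)"
proof -
  have "linear (blinfun_apply A)"
    by (simp add: blinfun.bounded_linear_right bounded_linear.linear)
  then show ?thesis unfolding bl_range_def by (simp add: linear_subspace_image)
qed

lemma generalized_inverse_apply:
  assumes "generalized_inverse A A'"
  shows "A' (A (A' v)) = A' v" "A (A' (A u)) = A u"
  using assms unfolding generalized_inverse_def by (metis blinfun_apply_blinfun_compose)+

text \<open>The product A'A is a projection, and its range is its fixed space. In this form the
  range of \<open>A'\<close> is visibly closed.\<close>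

lemma bl_range_generalized_inverse:
  assumes "generalized_inverse A A'"
  shows "bl_range A' = {v. A' (A v) = v}"
  using generalized_inverse_apply[OF assms] by (auto simp: bl_range_def) (metis rangeI)

lemma closed_bl_range_generalized_inverse:
  assumes "generalized_inverse A A'"
  shows "closed (bl_range A')"
  unfolding bl_range_generalized_inverse[OF assms]
  by (intro closed_Collect_eq continuous_intros)

text \<open>Transversality lets \<open>A'\<close> be cancelled in \<open>A' (B v) = 0\<close>. Since
  \<open>A\<close> is injective on the range of \<open>A'\<close> and annihilates
  \<open>v - A' (A v)\<close>, applying \<open>A\<close> gives the condition on the right. Thus the
  kernel of \<open>B\<close> is the preimage of that of \<open>A\<close> under id + A'(B -
  A).\<close>

lemma bl_kernel_perturbed:
  fixes A B :: "'a::real_normed_vector \<Rightarrow>\<^sub>L 'b::real_normed_vector" and A' :: "'b \<Rightarrow>\<^sub>L 'a"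
  assumes gi: "generalized_inverse A A'"
    and tr: "bl_range B \<inter> bl_kernel A' = {0}"
  shows "v \<in> bl_kernel B \<longleftrightarrow> v + A' (B v - A v) \<in> bl_kernel A"
proof -
  note g = generalized_inverse_apply[OF gi]
  have "v \<in> bl_kernel B \<longleftrightarrow> A' (B v) = 0"
    using tr by (auto simp: bl_kernel_def bl_range_def blinfun.zero_right)
  also have "\<dots> \<longleftrightarrow> A (A' (B v)) = 0"
    using g(1)[of "B v"] by (metis blinfun.zero_right)
  also have "A (A' (B v)) = A (v + A' (B v - A v))"
    by (simp add: blinfun.bilinear_simps g)
  finally show ?thesis by (simp add: bl_kernel_def)
qed

text \<open>The inverse \<open>J\<close> of id + A'(B - A) carries the kernel of \<open>A\<close>
  onto that of \<open>B\<close> and moves each vector only along the range of \<open>A'\<close>.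
  Hence the image is a graph, and the range of \<open>A'\<close> remains a complement.\<close>

lemma bl_kernel_graph:
  fixes A B :: "'a::banach \<Rightarrow>\<^sub>L 'b::real_normed_vector" and A' :: "'b \<Rightarrow>\<^sub>L 'a"
  assumes gi: "generalized_inverse A A'"
    and tr: "bl_range B \<inter> bl_kernel A' = {0}"
    and n: "norm (A' o\<^sub>L (B - A)) < 1"
  shows "direct_sum_decomp (bl_kernel B) (bl_range A')"
    and "is_graph_op (bl_kernel A) (bl_range A') (bl_kernel B)
      (\<lambda>e\<in>bl_kernel A. id_plus_inv (A' o\<^sub>L (B - A)) e - e)"
proof -
  define J where "J = id_plus_inv (A' o\<^sub>L (B - A))"
  note g = generalized_inverse_apply[OF gi]
  have right: "J v + A' (B (J v) - A (J v)) = v" for v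
    using id_plus_inv_right[OF n, of v] by (simp add: J_def blinfun.diff_left)
  have left: "J (v + A' (B v - A v)) = v" for v
    using id_plus_inv_left[OF n, of v] by (simp add: J_def blinfun.diff_left)
  have JB: "J m \<in> bl_kernel B \<longleftrightarrow> m \<in> bl_kernel A" for m
    using bl_kernel_perturbed[OF gi tr, of "J m"] by (simp add: right)
  have JE: "J m - m \<in> bl_range A'" for m
  proof -
    have "m - J m = A' (B (J m) - A (J m))"
      using right[of m] by (metis add_diff_cancel_left')
    then have "m - J m \<in> bl_range A'" unfolding bl_range_def by blast
    then show ?thesis using subspace_neg[OF subspace_bl_range] by fastforce
  qed
  show "direct_sum_decomp (bl_kernel B) (bl_range A')"
    unfolding direct_sum_decomp_def
  proof (intro conjI subspace_bl_kernel closed_bl_kernel subspace_bl_range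
      closed_bl_range_generalized_inverse[OF gi])
    show "{a + b |a b. a \<in> bl_kernel B \<and> b \<in> bl_range A'} = UNIV"
    proof (intro equalityI subset_UNIV subsetI)
      fix v :: 'a
      \<comment> \<open>The component of \<open>v\<close> in the kernel of \<open>A\<close>.
        Replacing \<open>m\<close> by \<open>J m\<close> only alters the summand in the range of
        \<open>A'\<close>.\<close>
      define m where "m = v - A' (A v)"
      have "m \<in> bl_kernel A" by (simp add: m_def bl_kernel_def blinfun.diff_right g)
      then have 1: "J m \<in> bl_kernel B" by (simp add: JB)
      have "A' (A v) - (J m - m) \<in> bl_range A'"
        by (intro subspace_diff subspace_bl_range JE) (auto simp: bl_range_def)
      moreover have "v = J m + (A' (A v) - (J m - m))" by (simp add: m_def)
      ultimately show "v \<in> {a + b |a b. a \<in> bl_kernel B \<and> b \<in> bl_range A'}"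
        using 1 by blast
    qed
    have "v = 0" if "v \<in> bl_kernel B" "v \<in> bl_range A'" for v
    proof -
      \<comment> \<open>This vector lies in the kernel of \<open>A\<close> and in the range of
        \<open>A'\<close>, so it vanishes; \<open>J\<close> then recovers
        \<open>v = 0\<close>.\<close>
      let ?w = "v + A' (B v - A v)"
      have "?w \<in> bl_range A'"
        using that subspace_bl_range by (auto intro!: subspace_add simp: bl_range_def)
      then have "A' (A ?w) = ?w" using bl_range_generalized_inverse[OF gi] by blast
      moreover have "A ?w = 0"
        using bl_kernel_perturbed[OF gi tr] that by (simp add: bl_kernel_def)
      ultimately have "?w = 0" by (simp add: blinfun.zero_right)
      then show ?thesis using left[of v] by (simp add: blinfun.zero_right)
    qed
    then show "bl_kernel B \<inter> bl_range A' = {0}"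
      using subspace_0[OF subspace_bl_kernel] subspace_0[OF subspace_bl_range] by blast
  qed
  show "is_graph_op (bl_kernel A) (bl_range A') (bl_kernel B)
      (\<lambda>e\<in>bl_kernel A. id_plus_inv (A' o\<^sub>L (B - A)) e - e)"
    unfolding is_graph_op_def bounded_ops_def J_def[symmetric]
  proof (intro conjI CollectI)
    show "(\<lambda>e\<in>bl_kernel A. J e - e) \<in> bl_kernel A \<rightarrow>\<^sub>E bl_range A'" using JE by auto
    show "\<exists>K. \<forall>x\<in>bl_kernel A. norm ((\<lambda>e\<in>bl_kernel A. J e - e) x) \<le> K * norm x"
    proof (intro exI ballI)
      fix x assume "x \<in> bl_kernel A"
      then show "norm ((\<lambda>e\<in>bl_kernel A. J e - e) x) \<le> norm (J - id_blinfun) * norm x"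
        using norm_blinfun[of "J - id_blinfun" x] by (simp add: blinfun.diff_left)
    qed
    show "bl_kernel B = {e + (\<lambda>e\<in>bl_kernel A. J e - e) e |e. e \<in> bl_kernel A}"
      using JB left by (auto simp: bl_kernel_perturbed[OF gi tr]) (metis left)
  qed (use subspace_bl_kernel[of A] in
      \<open>auto simp: subspace_def blinfun.bilinear_simps algebra_simps\<close>)
qed

lemma onorm_on_le:
  fixes A :: "'a::real_normed_vector set"
  assumes "0 \<in> A" "\<And>x. x \<in> A \<Longrightarrow> norm (T x) \<le> b * norm x" "0 \<le> b"
  shows "\<bar>onorm_on A T\<bar> \<le> b"
proof -
  have le: "norm (T x) / norm x \<le> b" if "x \<in> A" for x
    using assms(2)[OF that] assms(3) by (cases "x = 0") (auto simp: field_simps)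
  have "onorm_on A T \<le> b"
    unfolding onorm_on_def using assms(1) le by (intro cSUP_least) auto
  \<comment> \<open>Division by zero gives 0, so the point 0 contributes the quotient 0 and the
    supremum is nonnegative.\<close>
  moreover have "norm (T 0) / norm (0::'a) \<le> onorm_on A T"
    unfolding onorm_on_def using assms(1) le by (intro cSUP_upper bdd_aboveI2[where M = b]) auto
  ultimately show ?thesis by simp
qed

section \<open>The integral manifold\<close>

text \<open>The manifold is the preimage of the kernel of \<open>P\<close> under \<phi>, with one
  chart for all its points. The last hypothesis says that \<open>M x\<close> is the preimage of that
  kernel under the derivative of \<phi> at \<open>x\<close>, which is the tangent space of the
  preimage.\<close>

lemma level_set_integrable:
  fixes \<phi> :: "'a::banach \<Rightarrow> 'a"
  assumes der: "\<And>x. x \<in> ball a r \<Longrightarrow> (\<phi> has_derivative blinfun_apply (id_blinfun + K x)) (at x)"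
    and contK: "continuous_on (ball a r) K"
    and small: "\<And>x. x \<in> ball a r \<Longrightarrow> norm (K x) \<le> 1/2"
    and N: "splits (bl_kernel P)"
    and r: "0 < r" "ball a r \<subseteq> \<Lambda>" "\<phi> a \<in> bl_kernel P"
    and M: "\<And>x v. x \<in> ball a r \<Longrightarrow> v \<in> M x \<longleftrightarrow> v + K x v \<in> bl_kernel P"
  shows "C1_integrable_at \<Lambda> M a"
proof -
  let ?W = "ball a r" and ?N = "bl_kernel P"
  obtain \<psi> where diff: "C1_diffeo_on ?W \<phi>" and \<psi>\<phi>: "\<And>x. x \<in> ?W \<Longrightarrow> \<psi> (\<phi> x) = x"
    and C1: "C1_with_derivative (\<phi> ` ?W) \<psi> (\<lambda>y. id_plus_inv (K (\<psi> y)))"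
    using ball_diffeo_near_id[OF der contK small] by blast
  have opn: "open (\<phi> ` ?W)" using diff by (simp add: C1_diffeo_on_def)
  define S where "S = {x\<in>?W. \<phi> x \<in> ?N}"
  have "\<phi> ` (S \<inter> ?W) = ?N \<inter> \<phi> ` ?W" by (auto simp: S_def)
  then have sub: "C1_submanifold S"
    unfolding C1_submanifold_def
    using N diff opn by (intro ballI exI[of _ ?N] exI[of _ ?W] exI[of _ \<phi>])
      (auto simp: S_def intro!: openin_open_Int)
  have N': "y \<in> ?N \<longleftrightarrow> P y = 0" for y by (simp add: bl_kernel_def)
  have "M x = velocities S x" if "x \<in> S" for x
  proof (intro equalityI subsetI)
    have x: "x \<in> ?W" "\<phi> x \<in> ?N" using that by (auto simp: S_def)
    have n: "norm (K x) < 1" using small[OF x(1)] by simp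
    {
      fix v assume "v \<in> velocities S x"
      then obtain c \<epsilon> where c: "0 < \<epsilon>" "\<And>t. t \<in> {-\<epsilon><..<\<epsilon>} \<Longrightarrow> c t \<in> S" "c 0 = x"
        "(c has_vector_derivative v) (at (0::real))"
        unfolding velocities_def by blast
      \<comment> \<open>The curve stays in \<open>S\<close>, so \<open>P (\<phi> (c t))\<close> is
        constantly 0. Comparing this with the chain rule puts \<open>v\<close> in
        \<open>M x\<close>.\<close>
      have "((\<lambda>t. P (\<phi> (c t))) has_derivative (\<lambda>t. P ((id_blinfun + K x) (t *\<^sub>R v)))) (at 0)"
        using c(4) der[OF x(1)] c(3) unfolding has_vector_derivative_def
        by (intro bounded_linear.has_derivative[OF blinfun.bounded_linear_right] has_derivative_compose[of c _ 0 UNIV \<phi>]) auto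
      moreover have "((\<lambda>t. P (\<phi> (c t))) has_derivative (\<lambda>t. 0)) (at 0)"
      proof (rule has_derivative_transform_within_open[OF has_derivative_const])
        show "open {-\<epsilon><..<\<epsilon>}" "0 \<in> {-\<epsilon><..<\<epsilon>}" using c(1) by auto
        show "0 = P (\<phi> (c t))" if "t \<in> {-\<epsilon><..<\<epsilon>}" for t
          using c(2)[OF that] by (simp add: S_def N')
      qed
      ultimately have "(\<lambda>t::real. P ((id_blinfun + K x) (t *\<^sub>R v))) = (\<lambda>t. 0)"
        by (rule has_derivative_unique)
      from fun_cong[OF this, of 1] show "v \<in> M x"
        using M[OF x(1)] by (simp add: N' blinfun.add_left)
    next
      fix v assume v: "v \<in> M x"
      \<comment> \<open>For the converse, \<open>w\<close> is the image of \<open>v\<close> under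
        the derivative of \<phi>. The line through \<open>\<phi> x\<close> in direction
        \<open>w\<close> stays in the kernel of \<open>P\<close>, and \<psi> pulls it back to a
        curve in \<open>S\<close>.\<close>
      define w where "w = v + K x v"
      have w: "w \<in> ?N" using M[OF x(1)] v by (simp add: w_def)
      obtain e where e: "e > 0" "ball (\<phi> x) e \<subseteq> \<phi> ` ?W"
        using opn x(1) open_contains_ball by blast
      \<comment> \<open>Adding 1 keeps the denominator positive when \<open>w = 0\<close>.\<close>
      define \<epsilon> where "\<epsilon> = e / (norm w + 1)"
      have \<epsilon>: "0 < \<epsilon>" using e by (simp add: \<epsilon>_def add_nonneg_pos)
      have inW: "\<phi> x + t *\<^sub>R w \<in> \<phi> ` ?W" if "t \<in> {-\<epsilon><..<\<epsilon>}" for t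
      proof -
        have "\<bar>t\<bar> * norm w \<le> \<bar>t\<bar> * (norm w + 1)" by (simp add: mult_left_mono)
        also have "\<dots> < \<epsilon> * (norm w + 1)"
          using that by (intro mult_strict_right_mono) (auto simp: add_nonneg_pos)
        also have "\<dots> = e" by (simp add: \<epsilon>_def add_nonneg_eq_0_iff)
        finally have "\<phi> x + t *\<^sub>R w \<in> ball (\<phi> x) e" by (simp add: dist_norm)
        then show ?thesis using e by blast
      qed
      define c where "c t = \<psi> (\<phi> x + t *\<^sub>R w)" for t
      define D where "D t = id_plus_inv (K (c t)) w" for t
      have der_c: "(c has_vector_derivative D t) (at t)" if "t \<in> {-\<epsilon><..<\<epsilon>}" for t
      proof -
        have d\<psi>: "(\<psi> has_derivative blinfun_apply (id_plus_inv (K (c t)))) (at (\<phi> x + t *\<^sub>R w))"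
          using C1 inW[OF that] unfolding C1_with_derivative_def c_def by blast
        have "((\<lambda>t. \<phi> x + t *\<^sub>R w) has_derivative (\<lambda>h. h *\<^sub>R w)) (at t)"
          by (auto intro!: derivative_eq_intros)
        from has_derivative_compose[OF this d\<psi>] show ?thesis
          unfolding has_vector_derivative_def c_def D_def by (simp add: blinfun.scaleR_right)
      qed
      have "continuous_on (\<phi> ` ?W) (\<lambda>y. id_plus_inv (K (\<psi> y)))"
        using C1 by (simp add: C1_with_derivative_def)
      then have "continuous_on {-\<epsilon><..<\<epsilon>} (\<lambda>t. id_plus_inv (K (c t)))"
        unfolding c_def
      proof (rule continuous_on_compose2)
        show "continuous_on {-\<epsilon><..<\<epsilon>} (\<lambda>t. \<phi> x + t *\<^sub>R w)"
          by (intro continuous_intros)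
      qed (use inW in blast)
      then have "continuous_on {-\<epsilon><..<\<epsilon>} D"
        unfolding D_def by (intro continuous_intros)
      then have "c C1_differentiable_on {-\<epsilon><..<\<epsilon>}"
        using der_c unfolding C1_differentiable_on_def by blast
      moreover have "c t \<in> S" if t: "t \<in> {-\<epsilon><..<\<epsilon>}" for t
      proof -
        obtain y where y: "y \<in> ?W" "\<phi> x + t *\<^sub>R w = \<phi> y" using inW[OF t] by blast
        then have "c t = y" by (simp add: c_def \<psi>\<phi>)
        moreover have "\<phi> y \<in> ?N"
          using x(2) w unfolding y(2)[symmetric] by (simp add: N' blinfun.bilinear_simps)
        ultimately show ?thesis using y by (simp add: S_def)
      qed
      moreover have c0: "c 0 = x" using x by (simp add: c_def \<psi>\<phi>)
      \<comment> \<open>At 0 the velocity is \<open>id_plus_inv (K x) (v + K x v)\<close>, which is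
        \<open>v\<close>.\<close>
      moreover have "(c has_vector_derivative v) (at 0)"
        using der_c[of 0] \<epsilon> id_plus_inv_left[OF n, of v] by (simp add: D_def c0 w_def)
      ultimately show "v \<in> velocities S x"
        unfolding velocities_def using \<epsilon> by blast
    }
  qed
  then show ?thesis
    unfolding C1_integrable_at_def using sub r by (intro exI[of _ S]) (auto simp: S_def)
qed

theorem theorem3p2:
  fixes f :: "'a::banach \<Rightarrow> 'b::banach"
    and f' :: "'a \<Rightarrow> 'a \<Rightarrow>\<^sub>L 'b"
    and T\<^sub>0' :: "'b \<Rightarrow>\<^sub>L 'a"
    and U U\<^sub>0 :: "'a set"
    and x\<^sub>0 :: 'a
  assumes "open U"
    and "C1_with_derivative U f f'"
    and "x\<^sub>0 \<in> U"
    and "generalized_regular_point U f x\<^sub>0"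
    and "generalized_inverse (f' x\<^sub>0) T\<^sub>0'"
    and "open U\<^sub>0" and "x\<^sub>0 \<in> U\<^sub>0" and "U\<^sub>0 \<subseteq> U"
    and "\<And>x. x \<in> U\<^sub>0 \<Longrightarrow> T\<^sub>0' \<noteq> 0 \<Longrightarrow> norm (f' x - f' x\<^sub>0) < inverse (norm T\<^sub>0')"
    and "\<And>x. x \<in> U\<^sub>0 \<Longrightarrow> bl_range (f' x) \<inter> bl_kernel T\<^sub>0' = {0}"
  shows "cofinal_trivial U\<^sub>0 (\<lambda>x. bl_kernel (f' x)) x\<^sub>0 (bl_range T\<^sub>0') \<and>
         C1_integrable_at U\<^sub>0 (\<lambda>x. bl_kernel (f' x)) x\<^sub>0"
proof -
  define K where "K x = T\<^sub>0' o\<^sub>L (f' x - f' x\<^sub>0)" for x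
  note gi = assms(5) and tr = assms(10)
  have df: "(f has_derivative blinfun_apply (f' x)) (at x)" if "x \<in> U\<^sub>0" for x
    using assms(2,8) that by (auto simp: C1_with_derivative_def)
  have contf': "continuous_on U\<^sub>0 f'"
    using assms(2,8) continuous_on_subset by (auto simp: C1_with_derivative_def)
  have K1: "norm (K x) < 1" if x: "x \<in> U\<^sub>0" for x
  \<comment> \<open>The reciprocal norm counts as infinite when \<open>T\<^sub>0' = 0\<close>, so
    there is no bound to use; but then \<open>K x = 0\<close>.\<close>
  proof (cases "T\<^sub>0' = 0")
    case True then show ?thesis by (simp add: K_def)
  next
    case False
    have "norm (K x) \<le> norm T\<^sub>0' * norm (f' x - f' x\<^sub>0)"
      unfolding K_def by (rule norm_blinfun_compose)
    also have "\<dots> < norm T\<^sub>0' * inverse (norm T\<^sub>0')"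
      using assms(9)[OF x False] False by (intro mult_strict_left_mono) auto
    finally show ?thesis using False by simp
  qed
  have contK: "continuous_on U\<^sub>0 K" unfolding K_def
    by (intro bounded_bilinear.continuous_on[OF bounded_bilinear_blinfun_compose] continuous_intros contf')
  \<comment> \<open>The graph description holds wherever \<open>norm (K x) < 1\<close>, hence on
    \<open>U\<^sub>0\<close>. Continuity of the inverses and the diffeomorphism use the uniform
    bound 1/2, available near \<open>x\<^sub>0\<close> because
    \<open>K x\<^sub>0 = 0\<close>.\<close>
  have "open (U\<^sub>0 \<inter> K -` ball 0 (1/2))"
    by (rule continuous_open_preimage[OF contK assms(6) open_ball])
  moreover have "x\<^sub>0 \<in> U\<^sub>0 \<inter> K -` ball 0 (1/2)" using assms(7) by (simp add: K_def)
  ultimately obtain r where r: "r > 0" "ball x\<^sub>0 r \<subseteq> U\<^sub>0 \<inter> K -` ball 0 (1/2)"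
    using open_contains_ball by blast
  then have W: "ball x\<^sub>0 r \<subseteq> U\<^sub>0" and small: "\<And>x. x \<in> ball x\<^sub>0 r \<Longrightarrow> norm (K x) \<le> 1/2"
    by fastforce+
  note contK' = continuous_on_subset[OF contK W]
  note graph = bl_kernel_graph[OF gi tr, folded K_def, OF _ K1]
  let ?N = "bl_kernel (f' x\<^sub>0)" and ?E = "bl_range T\<^sub>0'"
  have cof: "cofinal_set U\<^sub>0 (\<lambda>x. bl_kernel (f' x)) ?E = U\<^sub>0"
    using graph(1) by (auto simp: cofinal_set_def)
  have "cofinal_trivial U\<^sub>0 (\<lambda>x. bl_kernel (f' x)) x\<^sub>0 ?E"
    unfolding cofinal_trivial_def cof
  proof (intro conjI exI ballI)
    show "x\<^sub>0 \<in> interior U\<^sub>0" using assms(6,7) by (simp add: interior_open)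
    let ?\<alpha> = "\<lambda>x. \<lambda>e\<in>?N. id_plus_inv (K x) e - e"
    show "is_graph_op ?N ?E (bl_kernel (f' x)) (?\<alpha> x)" if "x \<in> U\<^sub>0" for x
      using graph(2) that by blast
    show "open (ball x\<^sub>0 r)" "x\<^sub>0 \<in> ball x\<^sub>0 r" "ball x\<^sub>0 r \<subseteq> U\<^sub>0" using r W by auto
    fix x assume x: "x \<in> ball x\<^sub>0 r"
    have "continuous_on (ball x\<^sub>0 r) (\<lambda>x. id_plus_inv (K x))"
      by (rule continuous_on_id_plus_inv[OF contK' small])
    then have "(\<lambda>y. id_plus_inv (K y)) \<midarrow>x\<rightarrow> id_plus_inv (K x)"
      using x by (simp add: continuous_on_eq_continuous_at isCont_def)
    then have lim: "(\<lambda>y. norm (id_plus_inv (K y) - id_plus_inv (K x))) \<midarrow>x\<rightarrow> 0"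
      using LIM_zero tendsto_norm_zero by blast
    show "(\<lambda>y. onorm_on ?N (\<lambda>e. ?\<alpha> y e - ?\<alpha> x e)) \<midarrow>x\<rightarrow> 0"
    proof (rule Lim_null_comparison[OF always_eventually lim], intro allI)
      fix y
      \<comment> \<open>The identity terms cancel, so the difference of the graph operators is the
        restriction to \<open>?N\<close> of the difference of two inverses.\<close>
      have "\<bar>onorm_on ?N (\<lambda>e. ?\<alpha> y e - ?\<alpha> x e)\<bar> \<le> norm (id_plus_inv (K y) - id_plus_inv (K x))"
      proof (rule onorm_on_le)
        show "0 \<in> ?N" by (rule subspace_0[OF subspace_bl_kernel])
        fix e assume "e \<in> ?N"
        then show "norm (?\<alpha> y e - ?\<alpha> x e) \<le> norm (id_plus_inv (K y) - id_plus_inv (K x)) * norm e"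
          using norm_blinfun[of "id_plus_inv (K y) - id_plus_inv (K x)" e]
          by (simp add: blinfun.diff_left)
      qed simp
      then show "norm (onorm_on ?N (\<lambda>e. ?\<alpha> y e - ?\<alpha> x e)) \<le> norm (id_plus_inv (K y) - id_plus_inv (K x))"
        by simp
    qed
  qed
  moreover have "C1_integrable_at U\<^sub>0 (\<lambda>x. bl_kernel (f' x)) x\<^sub>0"
  proof (rule level_set_integrable[where P = "f' x\<^sub>0" and K = K])
    \<comment> \<open>The constants are chosen so that \<open>x\<^sub>0\<close> is sent to 0, which
      lies in the kernel; the derivative is id + K x.\<close>
    let ?\<phi> = "\<lambda>y. (y - x\<^sub>0) + T\<^sub>0' (f y - f x\<^sub>0 - f' x\<^sub>0 (y - x\<^sub>0))"
    show "(?\<phi> has_derivative blinfun_apply (id_blinfun + K x)) (at x)" if "x \<in> ball x\<^sub>0 r" for x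
    proof -
      have "x \<in> U\<^sub>0" using that W by blast
      then have "(?\<phi> has_derivative (\<lambda>h. (h - 0) + T\<^sub>0' (f' x h - 0 - f' x\<^sub>0 (h - 0)))) (at x)"
        by (intro has_derivative_add has_derivative_diff has_derivative_ident has_derivative_const
            bounded_linear.has_derivative[OF blinfun.bounded_linear_right] df)
      moreover have "(\<lambda>h. (h - 0) + T\<^sub>0' (f' x h - 0 - f' x\<^sub>0 (h - 0))) = blinfun_apply (id_blinfun + K x)"
        by (simp add: K_def blinfun.add_left blinfun.diff_left fun_eq_iff)
      ultimately show ?thesis by simp
    qed
    \<comment> \<open>The complement is \<open>?E\<close>, from the direct sum decomposition taken
      at \<open>x\<^sub>0\<close> itself.\<close>
    show "splits ?N" unfolding splits_def using graph(1)[OF assms(7) assms(7)] by blast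
    show "?\<phi> x\<^sub>0 \<in> ?N" by (simp add: bl_kernel_def blinfun.zero_right)
    show "v \<in> bl_kernel (f' x) \<longleftrightarrow> v + K x v \<in> ?N" if "x \<in> ball x\<^sub>0 r" for x v
      using bl_kernel_perturbed[OF gi tr, of x v] that W by (auto simp: K_def blinfun.diff_left)
  qed (use contK' small r W in auto)
  ultimately show ?thesis ..
qed

end
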